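(* Let $(u_1,v_1,u_2,v_2)$ be an orthonormal basis of $\mathbb{R}^4$, let $r_1,r_2>0$ and $0<\phi_2<\phi_1$. Let $$x=r_1T_1v_1+r_2T_2v_2\in\mathbb{R}^4,$$ $$t=r_1^2U_1\,u_1\wedge v_1+r_1r_2Z_{12}\,u_1\wedge v_2+r_1r_2Z_{21}\,u_2\wedge v_1+r_2^2U_2\,u_2\wedge v_2\in\Lambda^2\mathbb{R}^4\simeq\mathfrak{so}(4).$$ Then the following statements are equivalent: (1) $\det M_1=0$, where $$M_1=\begin{bmatrix}-T_1&0&-r_2^2T_2&0\\ 0&-T_2&0&-r_1^2T_1\\ Z_{21}&-Z_{12}&r_2^2U_2&-r_1^2U_1\\ Z_{12}&-Z_{21}&-r_1^2U_1&r_2^2U_2\end{bmatrix};$$ (2) $t^2x\in\mathrm{span}\{x\}$; (3) $A(\phi_1,\phi_2)r_1^4+\{B(\phi_1,\phi_2)-B(\phi_2,\phi_1)\}r_1^2r_2^2-A(\phi_2,\phi_1)r_2^4=0$.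
   Context: Functions: $T(\phi)=\frac{\sin\phi}{\phi}$, $U(\phi)=\frac{\phi-\sin\phi\cos\phi}{4\phi^2}$ for $\phi>0$, and $$Z(x,y)=\frac{y\cos y\sin x-x\cos x\sin y}{2y(x^2-y^2)}\quad(x,y>0,\ x\neq y).$$ Abbreviations: $T_k=T(\phi_k)$, $U_k=U(\phi_k)$, $Z_{jk}=Z(\phi_j,\phi_k)$. For $x\ne y$ positive, $$A(x,y)=T(x)U(x)\big(T(x)Z(x,y)-T(y)U(x)\big),\qquad B(x,y)=T(y)Z(x,y)\big(T(x)Z(x,y)-T(y)U(x)\big).$$ $\Lambda^2\mathbb{R}^4$ is identified with the skew-symmetric matrices $\mathfrak{so}(4)$ by extending linearly $u\wedge v\simeq uv^T-vu^T$; $t^2$ is the matrix square. *)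

theory Defs
  imports "HOL-Analysis.Analysis"
begin

definition orthonormal_basis :: "'a::euclidean_space list \<Rightarrow> bool" where
  "orthonormal_basis bs \<longleftrightarrow>
     distinct bs \<and> pairwise orthogonal (set bs) \<and> (\<forall>b\<in>set bs. norm b = 1) \<and> span (set bs) = UNIV"

(* The decomposable bivector u \<and> v, identified with the skew-symmetric matrix u v\<^sup>T - v u\<^sup>T.
   Under this identification the second exterior power of real^'n is the space of
   skew-symmetric matrices, so linear combinations of bivectors are matrix combinations. *)
definition wedge :: "real^'n \<Rightarrow> real^'n \<Rightarrow> real^'n^'n" (infixl "\<and>\<^sub>m" 72) where
  "u \<and>\<^sub>m v = (\<chi> i j. u $ i * v $ j - v $ i * u $ j)"

(* T_fun and U_fun are meant for arguments > 0, and Z_fun, A_fun, B_fun for distinct positive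
   arguments; elsewhere they take the values given by division by zero. *)
definition T_fun :: "real \<Rightarrow> real" where
  "T_fun \<phi> = sin \<phi> / \<phi>"

definition U_fun :: "real \<Rightarrow> real" where
  "U_fun \<phi> = (\<phi> - sin \<phi> * cos \<phi>) / (4 * \<phi>\<^sup>2)"

(* Not symmetric in its two arguments. *)
definition Z_fun :: "real \<Rightarrow> real \<Rightarrow> real" where
  "Z_fun x y = (y * cos y * sin x - x * cos x * sin y) / (2 * y * (x\<^sup>2 - y\<^sup>2))"

definition A_fun :: "real \<Rightarrow> real \<Rightarrow> real" where
  "A_fun x y = T_fun x * U_fun x * (T_fun x * Z_fun x y - T_fun y * U_fun x)"

definition B_fun :: "real \<Rightarrow> real \<Rightarrow> real" where
  "B_fun x y = T_fun y * Z_fun x y * (T_fun x * Z_fun x y - T_fun y * U_fun x)"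

(* The inner vectors are the rows; in the index type 4 the literal 4 equals 0, so vector puts
   the fourth entry at index 0. *)
definition M1 :: "real \<Rightarrow> real \<Rightarrow> real \<Rightarrow> real \<Rightarrow> real^4^4" where
  "M1 r\<^sub>1 r\<^sub>2 \<phi>\<^sub>1 \<phi>\<^sub>2 = vector [
     vector [- T_fun \<phi>\<^sub>1, 0, - (r\<^sub>2\<^sup>2 * T_fun \<phi>\<^sub>2), 0],
     vector [0, - T_fun \<phi>\<^sub>2, 0, - (r\<^sub>1\<^sup>2 * T_fun \<phi>\<^sub>1)],
     vector [Z_fun \<phi>\<^sub>2 \<phi>\<^sub>1, - Z_fun \<phi>\<^sub>1 \<phi>\<^sub>2, r\<^sub>2\<^sup>2 * U_fun \<phi>\<^sub>2, - (r\<^sub>1\<^sup>2 * U_fun \<phi>\<^sub>1)],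
     vector [Z_fun \<phi>\<^sub>1 \<phi>\<^sub>2, - Z_fun \<phi>\<^sub>2 \<phi>\<^sub>1, - (r\<^sub>1\<^sup>2 * U_fun \<phi>\<^sub>1), r\<^sub>2\<^sup>2 * U_fun \<phi>\<^sub>2]]"

end

theory Submission
  imports Defs
begin

text \<open>Let \<open>V\<close> be the plane spanned by \<open>v\<^sub>1, v\<^sub>2\<close> and \<open>U\<close> the plane spanned by
  \<open>u\<^sub>1, u\<^sub>2\<close>. Only bivectors \<open>u\<^sub>i \<and>\<^sub>m v\<^sub>j\<close> occur in \<open>t\<close>, so \<open>t\<close> exchanges the two planes:
  if \<open>K\<close> is the matrix of coefficients of \<open>t\<close>, then \<open>t\<close> acts as \<open>K\<close> from \<open>V\<close> to \<open>U\<close>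
  and as the negative transpose of \<open>K\<close> from \<open>U\<close> to \<open>V\<close>. Since \<open>x\<close> lies in \<open>V\<close>, so does \<open>t\<^sup>2 x\<close>,
  and \<open>t\<^sup>2 x = - K\<^sup>T K x\<close> there (lemma \<open>bivector_square_mult\<close>). Two vectors of a plane are
  parallel exactly when the cross product of their coordinates vanishes (lemma
  \<open>orthonormal_in_span_iff\<close>), which turns \<open>t\<^sup>2 x \<in> span {x}\<close> into one polynomial equation.

  With \<open>p = r\<^sub>1\<^sup>2 U\<^sub>1 T\<^sub>1 + r\<^sub>2\<^sup>2 Z\<^sub>1\<^sub>2 T\<^sub>2\<close> and \<open>q = r\<^sub>1\<^sup>2 Z\<^sub>2\<^sub>1 T\<^sub>1 + r\<^sub>2\<^sup>2 U\<^sub>2 T\<^sub>2\<close>, the vector \<open>K x\<close>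
  is \<open>r\<^sub>1 p u\<^sub>1 + r\<^sub>2 q u\<^sub>2\<close>, and the cross product is, up to sign, \<open>r\<^sub>1 r\<^sub>2\<close> times
  \<open>r\<^sub>1\<^sup>2 (T\<^sub>1 Z\<^sub>1\<^sub>2 - T\<^sub>2 U\<^sub>1) p - r\<^sub>2\<^sup>2 (T\<^sub>2 Z\<^sub>2\<^sub>1 - T\<^sub>1 U\<^sub>2) q\<close>.
  Multiplying out gives the quartic form in \<open>r\<^sub>1, r\<^sub>2\<close> with coefficients \<open>A\<close> and \<open>B\<close>.
  The determinant of \<open>M1\<close> is this quartic itself (lemma \<open>det_M1\<close>). To see where it comes from,
  let \<open>T\<^sub>1\<close> and \<open>T\<^sub>2\<close> be nonzero, multiply the last two columns by them and use the first two
  columns to clear the last two entries of the first two rows: the pivots are \<open>- T\<^sub>1\<close> and \<open>- T\<^sub>2\<close>,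
  and there remains the block with rows
  \<open>(- r\<^sub>2\<^sup>2 (T\<^sub>2 Z\<^sub>2\<^sub>1 - T\<^sub>1 U\<^sub>2), r\<^sub>1\<^sup>2 (T\<^sub>1 Z\<^sub>1\<^sub>2 - T\<^sub>2 U\<^sub>1))\<close> and \<open>(- p, q)\<close>, whose
  determinant is the expression above. The resulting identity between polynomials
  in \<open>r\<close>, \<open>T\<close>, \<open>U\<close> and \<open>Z\<close> persists when \<open>T\<^sub>1\<close> or \<open>T\<^sub>2\<close> vanishes.\<close>

lemma det_4:
  "det (A::'a::comm_ring_1^4^4) =
    A$1$1 * A$2$2 * A$3$3 * A$4$4 +
    A$1$1 * A$2$3 * A$3$4 * A$4$2 +
    A$1$1 * A$2$4 * A$3$2 * A$4$3 +
    A$1$2 * A$2$1 * A$3$4 * A$4$3 +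
    A$1$2 * A$2$3 * A$3$1 * A$4$4 +
    A$1$2 * A$2$4 * A$3$3 * A$4$1 +
    A$1$3 * A$2$1 * A$3$2 * A$4$4 +
    A$1$3 * A$2$2 * A$3$4 * A$4$1 +
    A$1$3 * A$2$4 * A$3$1 * A$4$2 +
    A$1$4 * A$2$1 * A$3$3 * A$4$2 +
    A$1$4 * A$2$2 * A$3$1 * A$4$3 +
    A$1$4 * A$2$3 * A$3$2 * A$4$1 -
    A$1$1 * A$2$2 * A$3$4 * A$4$3 -
    A$1$1 * A$2$3 * A$3$2 * A$4$4 -
    A$1$1 * A$2$4 * A$3$3 * A$4$2 -
    A$1$2 * A$2$1 * A$3$3 * A$4$4 -
    A$1$2 * A$2$3 * A$3$4 * A$4$1 -
    A$1$2 * A$2$4 * A$3$1 * A$4$3 -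
    A$1$3 * A$2$1 * A$3$4 * A$4$2 -
    A$1$3 * A$2$2 * A$3$1 * A$4$4 -
    A$1$3 * A$2$4 * A$3$2 * A$4$1 -
    A$1$4 * A$2$1 * A$3$2 * A$4$3 -
    A$1$4 * A$2$2 * A$3$3 * A$4$1 -
    A$1$4 * A$2$3 * A$3$1 * A$4$2"
proof -
  have f1234: "finite {2::4, 3, 4}" "1 \<notin> {2::4, 3, 4}"
    by auto
  have f234: "finite {3::4, 4}" "2 \<notin> {3::4, 4}"
    by auto
  have f34: "finite {4::4}" "3 \<notin> {4::4}"
    by auto
  show ?thesis
    unfolding det_def UNIV_4
    unfolding sum_over_permutations_insert[OF f1234]
    unfolding sum_over_permutations_insert[OF f234]
    unfolding sum_over_permutations_insert[OF f34]
    unfolding permutes_sing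
    by (simp add: sign_swap_id permutation_swap_id permutation_compose sign_compose sign_id
        swap_id_eq)
qed

lemma vector_4:
  "(vector [a, b, c, d] :: 'a::zero^4) $ 1 = a"
  "(vector [a, b, c, d] :: 'a^4) $ 2 = b"
  "(vector [a, b, c, d] :: 'a^4) $ 3 = c"
  "(vector [a, b, c, d] :: 'a^4) $ 4 = d"
  unfolding vector_def by simp_all

lemma wedge_mult_vec: "(u \<and>\<^sub>m v) *v w = (v \<bullet> w) *\<^sub>R u - (u \<bullet> w) *\<^sub>R v"
proof (rule vec_eq_iff[THEN iffD2], rule allI)
  fix i
  have "((u \<and>\<^sub>m v) *v w) $ i = (\<Sum>j\<in>UNIV. v $ j * w $ j * u $ i - u $ j * w $ j * v $ i)"
    unfolding wedge_def matrix_vector_mult_def vec_lambda_beta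
    by (intro sum.cong refl) (simp add: algebra_simps)
  also have "\<dots> = ((v \<bullet> w) *\<^sub>R u - (u \<bullet> w) *\<^sub>R v) $ i"
    by (simp only: sum_subtractf sum_distrib_right inner_vec_def inner_real_def
        vector_minus_component vector_scaleR_component real_scaleR_def)
  finally show "((u \<and>\<^sub>m v) *v w) $ i = ((v \<bullet> w) *\<^sub>R u - (u \<bullet> w) *\<^sub>R v) $ i" .
qed

text \<open>In the two orthonormal frames, \<open>t\<close> maps the plane of \<open>v\<^sub>1, v\<^sub>2\<close> to that of \<open>u\<^sub>1, u\<^sub>2\<close> by its
  coefficient matrix and, being skew-symmetric, maps back by the negative transpose; the
  composition is minus a Gram matrix.\<close>

lemma bivector_square_mult:
  fixes u\<^sub>1 v\<^sub>1 u\<^sub>2 v\<^sub>2 :: "real^'n" and a b c d \<xi> \<eta> :: real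
  assumes unit: "u\<^sub>1 \<bullet> u\<^sub>1 = 1" "v\<^sub>1 \<bullet> v\<^sub>1 = 1" "u\<^sub>2 \<bullet> u\<^sub>2 = 1" "v\<^sub>2 \<bullet> v\<^sub>2 = 1"
    and orth: "u\<^sub>1 \<bullet> v\<^sub>1 = 0" "u\<^sub>1 \<bullet> u\<^sub>2 = 0" "u\<^sub>1 \<bullet> v\<^sub>2 = 0"
      "v\<^sub>1 \<bullet> u\<^sub>2 = 0" "v\<^sub>1 \<bullet> v\<^sub>2 = 0" "u\<^sub>2 \<bullet> v\<^sub>2 = 0"
  defines "t \<equiv> a *\<^sub>R (u\<^sub>1 \<and>\<^sub>m v\<^sub>1) + b *\<^sub>R (u\<^sub>1 \<and>\<^sub>m v\<^sub>2)
      + c *\<^sub>R (u\<^sub>2 \<and>\<^sub>m v\<^sub>1) + d *\<^sub>R (u\<^sub>2 \<and>\<^sub>m v\<^sub>2)"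
  shows "t *v (\<xi> *\<^sub>R v\<^sub>1 + \<eta> *\<^sub>R v\<^sub>2) = (a * \<xi> + b * \<eta>) *\<^sub>R u\<^sub>1 + (c * \<xi> + d * \<eta>) *\<^sub>R u\<^sub>2"
    and "t *v (\<xi> *\<^sub>R u\<^sub>1 + \<eta> *\<^sub>R u\<^sub>2) = - (a * \<xi> + c * \<eta>) *\<^sub>R v\<^sub>1 - (b * \<xi> + d * \<eta>) *\<^sub>R v\<^sub>2"
    and "(t ** t) *v (\<xi> *\<^sub>R v\<^sub>1 + \<eta> *\<^sub>R v\<^sub>2) =
      - (a * (a * \<xi> + b * \<eta>) + c * (c * \<xi> + d * \<eta>)) *\<^sub>R v\<^sub>1
      - (b * (a * \<xi> + b * \<eta>) + d * (c * \<xi> + d * \<eta>)) *\<^sub>R v\<^sub>2"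
proof -
  note orth' = orth orth[THEN trans[OF inner_commute]]
  have tw: "t *v w = a *\<^sub>R ((v\<^sub>1 \<bullet> w) *\<^sub>R u\<^sub>1 - (u\<^sub>1 \<bullet> w) *\<^sub>R v\<^sub>1)
      + b *\<^sub>R ((v\<^sub>2 \<bullet> w) *\<^sub>R u\<^sub>1 - (u\<^sub>1 \<bullet> w) *\<^sub>R v\<^sub>2)
      + c *\<^sub>R ((v\<^sub>1 \<bullet> w) *\<^sub>R u\<^sub>2 - (u\<^sub>2 \<bullet> w) *\<^sub>R v\<^sub>1)
      + d *\<^sub>R ((v\<^sub>2 \<bullet> w) *\<^sub>R u\<^sub>2 - (u\<^sub>2 \<bullet> w) *\<^sub>R v\<^sub>2)" for w
    by (simp only: t_def matrix_vector_mult_add_rdistrib scaleR_matrix_vector_assoc[symmetric]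
        wedge_mult_vec)
  show V: "t *v (\<xi> *\<^sub>R v\<^sub>1 + \<eta> *\<^sub>R v\<^sub>2) = (a * \<xi> + b * \<eta>) *\<^sub>R u\<^sub>1 + (c * \<xi> + d * \<eta>) *\<^sub>R u\<^sub>2"
    for \<xi> \<eta> by (simp add: tw unit orth' inner_add_right scaleR_add_left)
  show U: "t *v (\<xi> *\<^sub>R u\<^sub>1 + \<eta> *\<^sub>R u\<^sub>2) = - (a * \<xi> + c * \<eta>) *\<^sub>R v\<^sub>1 - (b * \<xi> + d * \<eta>) *\<^sub>R v\<^sub>2"
    for \<xi> \<eta> by (simp add: tw unit orth' inner_add_right scaleR_add_left scaleR_diff_left)
  show "(t ** t) *v (\<xi> *\<^sub>R v\<^sub>1 + \<eta> *\<^sub>R v\<^sub>2) =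
      - (a * (a * \<xi> + b * \<eta>) + c * (c * \<xi> + d * \<eta>)) *\<^sub>R v\<^sub>1
      - (b * (a * \<xi> + b * \<eta>) + d * (c * \<xi> + d * \<eta>)) *\<^sub>R v\<^sub>2"
    by (simp only: matrix_vector_mul_assoc[symmetric] V U)
qed

text \<open>Vanishing of the cross product is weaker than membership in the span only when
  the spanning vector is zero; the last hypothesis settles that case, and it holds for the image
  of the spanning vector under any linear map.\<close>

lemma orthonormal_in_span_iff:
  fixes v w :: "'a::real_inner" and a b c d :: real
  assumes "v \<bullet> v = 1" "w \<bullet> w = 1" "v \<bullet> w = 0"
    and zero: "c = 0 \<Longrightarrow> d = 0 \<Longrightarrow> a = 0 \<and> b = 0"
  shows "a *\<^sub>R v + b *\<^sub>R w \<in> span {c *\<^sub>R v + d *\<^sub>R w} \<longleftrightarrow> a * d = b * c"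
proof
  assume "a *\<^sub>R v + b *\<^sub>R w \<in> span {c *\<^sub>R v + d *\<^sub>R w}"
  then obtain k where k: "a *\<^sub>R v + b *\<^sub>R w = k *\<^sub>R (c *\<^sub>R v + d *\<^sub>R w)"
    by (auto simp: span_singleton)
  have "a = k * c"
    using arg_cong[OF k, of "\<lambda>y. v \<bullet> y"] assms(1-3) by (simp add: inner_add_right)
  moreover have "b = k * d"
    using arg_cong[OF k, of "\<lambda>y. w \<bullet> y"] assms(1-3)
    by (simp add: inner_add_right inner_commute[of w v])
  ultimately show "a * d = b * c"
    by simp
next
  assume eq: "a * d = b * c"
  have "\<exists>k. a = k * c \<and> b = k * d"
  proof (cases "c = 0")
    case True
    show ?thesis
    proof (cases "d = 0")
      case True
      then show ?thesis using zero \<open>c = 0\<close> by simp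
    next
      case False
      then show ?thesis using eq True by (intro exI[of _ "b / d"]) simp
    qed
  next
    case False
    then show ?thesis using eq by (intro exI[of _ "a / c"]) (simp add: field_simps)
  qed
  then obtain k where "a = k * c" "b = k * d"
    by blast
  then have "a *\<^sub>R v + b *\<^sub>R w = k *\<^sub>R (c *\<^sub>R v + d *\<^sub>R w)"
    by (simp add: scaleR_add_right)
  then show "a *\<^sub>R v + b *\<^sub>R w \<in> span {c *\<^sub>R v + d *\<^sub>R w}"
    by (auto simp: span_singleton)
qed

lemma det_M1:
  "det (M1 r\<^sub>1 r\<^sub>2 \<phi>\<^sub>1 \<phi>\<^sub>2) =
    A_fun \<phi>\<^sub>1 \<phi>\<^sub>2 * r\<^sub>1 ^ 4
      + (B_fun \<phi>\<^sub>1 \<phi>\<^sub>2 - B_fun \<phi>\<^sub>2 \<phi>\<^sub>1) * r\<^sub>1\<^sup>2 * r\<^sub>2\<^sup>2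
      - A_fun \<phi>\<^sub>2 \<phi>\<^sub>1 * r\<^sub>2 ^ 4"
  unfolding det_4 M1_def vector_4 A_fun_def B_fun_def
  by (simp add: algebra_simps power2_eq_square power4_eq_xxxx)

theorem theorem1p3:
  fixes u\<^sub>1 v\<^sub>1 u\<^sub>2 v\<^sub>2 x :: "real^4"
    and t :: "real^4^4"
    and r\<^sub>1 r\<^sub>2 \<phi>\<^sub>1 \<phi>\<^sub>2 :: real
  assumes "orthonormal_basis [u\<^sub>1, v\<^sub>1, u\<^sub>2, v\<^sub>2]"
    and "r\<^sub>1 > 0" and "r\<^sub>2 > 0"
    and "0 < \<phi>\<^sub>2" and "\<phi>\<^sub>2 < \<phi>\<^sub>1"
    and "x = (r\<^sub>1 * T_fun \<phi>\<^sub>1) *\<^sub>R v\<^sub>1 + (r\<^sub>2 * T_fun \<phi>\<^sub>2) *\<^sub>R v\<^sub>2"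
    and "t = (r\<^sub>1\<^sup>2 * U_fun \<phi>\<^sub>1) *\<^sub>R (u\<^sub>1 \<and>\<^sub>m v\<^sub>1)
           + (r\<^sub>1 * r\<^sub>2 * Z_fun \<phi>\<^sub>1 \<phi>\<^sub>2) *\<^sub>R (u\<^sub>1 \<and>\<^sub>m v\<^sub>2)
           + (r\<^sub>1 * r\<^sub>2 * Z_fun \<phi>\<^sub>2 \<phi>\<^sub>1) *\<^sub>R (u\<^sub>2 \<and>\<^sub>m v\<^sub>1)
           + (r\<^sub>2\<^sup>2 * U_fun \<phi>\<^sub>2) *\<^sub>R (u\<^sub>2 \<and>\<^sub>m v\<^sub>2)"
  shows "(det (M1 r\<^sub>1 r\<^sub>2 \<phi>\<^sub>1 \<phi>\<^sub>2) = 0 \<longleftrightarrow> (t ** t) *v x \<in> span {x})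
       \<and> ((t ** t) *v x \<in> span {x} \<longleftrightarrow>
            A_fun \<phi>\<^sub>1 \<phi>\<^sub>2 * r\<^sub>1 ^ 4
              + (B_fun \<phi>\<^sub>1 \<phi>\<^sub>2 - B_fun \<phi>\<^sub>2 \<phi>\<^sub>1) * r\<^sub>1\<^sup>2 * r\<^sub>2\<^sup>2
              - A_fun \<phi>\<^sub>2 \<phi>\<^sub>1 * r\<^sub>2 ^ 4 = 0)"
proof -
  define T\<^sub>1 T\<^sub>2 U\<^sub>1 U\<^sub>2 where T_def: "T\<^sub>1 = T_fun \<phi>\<^sub>1" "T\<^sub>2 = T_fun \<phi>\<^sub>2"
    and U_def: "U\<^sub>1 = U_fun \<phi>\<^sub>1" "U\<^sub>2 = U_fun \<phi>\<^sub>2"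
  define Z\<^sub>1\<^sub>2 Z\<^sub>2\<^sub>1 where Z_def: "Z\<^sub>1\<^sub>2 = Z_fun \<phi>\<^sub>1 \<phi>\<^sub>2" "Z\<^sub>2\<^sub>1 = Z_fun \<phi>\<^sub>2 \<phi>\<^sub>1"
  let ?Q = "A_fun \<phi>\<^sub>1 \<phi>\<^sub>2 * r\<^sub>1 ^ 4
      + (B_fun \<phi>\<^sub>1 \<phi>\<^sub>2 - B_fun \<phi>\<^sub>2 \<phi>\<^sub>1) * r\<^sub>1\<^sup>2 * r\<^sub>2\<^sup>2
      - A_fun \<phi>\<^sub>2 \<phi>\<^sub>1 * r\<^sub>2 ^ 4"
  have unit: "u\<^sub>1 \<bullet> u\<^sub>1 = 1" "v\<^sub>1 \<bullet> v\<^sub>1 = 1" "u\<^sub>2 \<bullet> u\<^sub>2 = 1" "v\<^sub>2 \<bullet> v\<^sub>2 = 1"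
    using assms(1) by (simp_all add: orthonormal_basis_def dot_square_norm)
  have orth: "u\<^sub>1 \<bullet> v\<^sub>1 = 0" "u\<^sub>1 \<bullet> u\<^sub>2 = 0" "u\<^sub>1 \<bullet> v\<^sub>2 = 0"
      "v\<^sub>1 \<bullet> u\<^sub>2 = 0" "v\<^sub>1 \<bullet> v\<^sub>2 = 0" "u\<^sub>2 \<bullet> v\<^sub>2 = 0"
    using assms(1) by (auto simp: orthonormal_basis_def pairwise_def orthogonal_def)
  \<comment> \<open>The coordinates of \<open>t x\<close> in the basis \<open>u\<^sub>1, u\<^sub>2\<close>, then those of \<open>t\<^sup>2 x\<close> in \<open>v\<^sub>1, v\<^sub>2\<close>.\<close>
  define a b where a_def: "a = r\<^sub>1\<^sup>2 * U\<^sub>1 * (r\<^sub>1 * T\<^sub>1) + r\<^sub>1 * r\<^sub>2 * Z\<^sub>1\<^sub>2 * (r\<^sub>2 * T\<^sub>2)"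
    and b_def: "b = r\<^sub>1 * r\<^sub>2 * Z\<^sub>2\<^sub>1 * (r\<^sub>1 * T\<^sub>1) + r\<^sub>2\<^sup>2 * U\<^sub>2 * (r\<^sub>2 * T\<^sub>2)"
  define \<alpha> \<beta> where \<alpha>_def: "\<alpha> = - (r\<^sub>1\<^sup>2 * U\<^sub>1 * a + r\<^sub>1 * r\<^sub>2 * Z\<^sub>2\<^sub>1 * b)"
    and \<beta>_def: "\<beta> = - (r\<^sub>1 * r\<^sub>2 * Z\<^sub>1\<^sub>2 * a + r\<^sub>2\<^sup>2 * U\<^sub>2 * b)"
  have "(t ** t) *v x = \<alpha> *\<^sub>R v\<^sub>1 + \<beta> *\<^sub>R v\<^sub>2"
    unfolding assms(6,7) T_def[symmetric] U_def[symmetric] Z_def[symmetric]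
      bivector_square_mult(3)[OF unit orth] \<alpha>_def \<beta>_def a_def b_def
    by (simp only: diff_conv_add_uminus scaleR_minus_left)
  then have "(t ** t) *v x \<in> span {x} \<longleftrightarrow>
      \<alpha> *\<^sub>R v\<^sub>1 + \<beta> *\<^sub>R v\<^sub>2 \<in> span {(r\<^sub>1 * T\<^sub>1) *\<^sub>R v\<^sub>1 + (r\<^sub>2 * T\<^sub>2) *\<^sub>R v\<^sub>2}"
    by (simp add: assms(6) T_def)
  also have "\<dots> \<longleftrightarrow> \<alpha> * (r\<^sub>2 * T\<^sub>2) = \<beta> * (r\<^sub>1 * T\<^sub>1)"
    by (rule orthonormal_in_span_iff[OF unit(2,4) orth(5)])
      (auto simp: \<alpha>_def \<beta>_def a_def b_def)
  also have "\<dots> \<longleftrightarrow> r\<^sub>1 * r\<^sub>2 * ?Q = 0"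
  proof -
    have "\<alpha> * (r\<^sub>2 * T\<^sub>2) - \<beta> * (r\<^sub>1 * T\<^sub>1) = r\<^sub>1 * r\<^sub>2 * ?Q"
      unfolding A_fun_def B_fun_def T_def[symmetric] U_def[symmetric] Z_def[symmetric]
        \<alpha>_def \<beta>_def a_def b_def
      by (simp add: algebra_simps power2_eq_square power4_eq_xxxx)
    then show ?thesis
      by (simp only: eq_iff_diff_eq_0[of "\<alpha> * (r\<^sub>2 * T\<^sub>2)"])
  qed
  also have "\<dots> \<longleftrightarrow> ?Q = 0"
    using assms(2,3) by simp
  finally show ?thesis
    by (simp add: det_M1)
qed

end
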